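(* Let $\mathcal D=D_1\times\dots\times D_n$ where each $D_i$ is the node set of a finite rooted tree $T_i$, and let $f:\mathcal D\to\mathbb R$. (a) If $f$ is strongly tree-submodular, then for all $x,y\in\mathcal D$ and every integer $d\ge0$, $$f(x)+f(y)\ge f(x\uparrow^d y)+f(x\downarrow_d y).$$ (b) Conversely, if $f(x)+f(y)\ge f(x\uparrow^d y)+f(x\downarrow_d y)$ holds for all $x,y\in\mathcal D$ and all integers $d\ge0$, then $f$ is strongly tree-submodular.
   Context: For $a,b\in D_i$: $a\preceq b$ means $a$ is an ancestor of $b$ in $T_i$ (i.e. $a$ lies on the path from $b$ to the root $r_i$; every node is an ancestor of itself). $\mathcal P[a\to b]$ is the unique path from $a$ to $b$ in $T_i$, $\rho(a,b)$ its number of edges, and for an integer $d\ge0$, $\mathcal P[a\to b,d]$ is the $d$-th node of this path (so $\mathcal P[a\to b,0]=a$), with $\mathcal P[a\to b,d]=b$ if $d>\rho(a,b)$. $a\wedge b$ is the unique node on $\mathcal P[a\to b]$ that is an ancestor of both $a$ and $b$. Define $a\sqcap b,a\sqcup b$ as the unique pair with $\{a\sqcap b,a\sqcup b\}=\{\mathcal P[a\to b,\lfloor d/2\rfloor],\mathcal P[a\to b,\lceil d/2\rceil]\}$, $d=\rho(a,b)$, and $a\sqcap b\preceq a\sqcup b$. For an integer $d\ge0$ define $a\uparrow^d b=\mathcal P[a\to b,d]\wedge b$ and $a\downarrow_d b=\mathcal P[a\to b,\rho(a\uparrow^d b,\,b)]$. All these operations are extended to $\mathcal D$ componentwise. $f$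 is strongly tree-submodular if $f(x)+f(y)\ge f(x\sqcap y)+f(x\sqcup y)$ for all $x,y\in\mathcal D$. *)

theory Defs
  imports
    Complex_Main
    "HOL-Library.FuncSet"
    "Graph_Theory.Digraph_Component"
    "Graph_Theory.Vertex_Walk"
begin

text \<open>
  Undirected graphs are symmetric digraphs here, so every edge traversed back and forth is
  a \<^emph>\<open>cycle\<close> of length two in the sense of \<^theory>\<open>Graph_Theory.Arc_Walk\<close>. In a
  loop-free graph without parallel arcs the cycles of the undirected graph are those of
  length at least three; the constant \<^const>\<open>tree\<close> of the library is therefore not suitable.
\<close>

definition rooted_tree :: "'a pair_pre_digraph \<Rightarrow> 'a \<Rightarrow> bool" where
  "rooted_tree T r \<longleftrightarrow>
     pair_graph T \<and> Digraph_Component.connected (with_proj T) \<and>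
     \<not> (\<exists>p. pre_digraph.cycle (with_proj T) p \<and> 3 \<le> length p) \<and>
     r \<in> pverts T"

definition tree_path :: "'a pair_pre_digraph \<Rightarrow> 'a \<Rightarrow> 'a \<Rightarrow> 'a list" where
  "tree_path T a b = (THE p. vpath p (with_proj T) \<and> hd p = a \<and> last p = b)"

definition tree_dist :: "'a pair_pre_digraph \<Rightarrow> 'a \<Rightarrow> 'a \<Rightarrow> nat" where
  "tree_dist T a b = vwalk_length (tree_path T a b)"

definition path_node :: "'a pair_pre_digraph \<Rightarrow> 'a \<Rightarrow> 'a \<Rightarrow> nat \<Rightarrow> 'a" where
  "path_node T a b d = (if d \<le> tree_dist T a b then tree_path T a b ! d else b)"

definition ancestor :: "'a pair_pre_digraph \<Rightarrow> 'a \<Rightarrow> 'a \<Rightarrow> 'a \<Rightarrow> bool" where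
  "ancestor T r a b \<longleftrightarrow> a \<in> set (tree_path T b r)"

definition tree_meet :: "'a pair_pre_digraph \<Rightarrow> 'a \<Rightarrow> 'a \<Rightarrow> 'a \<Rightarrow> 'a" where
  "tree_meet T r a b =
     (THE c. c \<in> set (tree_path T a b) \<and> ancestor T r c a \<and> ancestor T r c b)"

text \<open>
  The two middle nodes of the path from \<open>a\<close> to \<open>b\<close>, the ancestor first; \<open>d div 2\<close> and
  \<open>(d + 1) div 2\<close> are the floor and the ceiling of \<open>d / 2\<close>.
\<close>

definition mid_pair :: "'a pair_pre_digraph \<Rightarrow> 'a \<Rightarrow> 'a \<Rightarrow> 'a \<Rightarrow> 'a \<times> 'a" where
  "mid_pair T r a b =
     (THE (u, v).
        {u, v} = {path_node T a b (tree_dist T a b div 2),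
                  path_node T a b ((tree_dist T a b + 1) div 2)} \<and>
        ancestor T r u v)"

definition tree_sqcap :: "'a pair_pre_digraph \<Rightarrow> 'a \<Rightarrow> 'a \<Rightarrow> 'a \<Rightarrow> 'a" where
  "tree_sqcap T r a b = fst (mid_pair T r a b)"

definition tree_sqcup :: "'a pair_pre_digraph \<Rightarrow> 'a \<Rightarrow> 'a \<Rightarrow> 'a \<Rightarrow> 'a" where
  "tree_sqcup T r a b = snd (mid_pair T r a b)"

definition tree_up :: "nat \<Rightarrow> 'a pair_pre_digraph \<Rightarrow> 'a \<Rightarrow> 'a \<Rightarrow> 'a \<Rightarrow> 'a" where
  "tree_up d T r a b = tree_meet T r (path_node T a b d) b"

definition tree_down :: "nat \<Rightarrow> 'a pair_pre_digraph \<Rightarrow> 'a \<Rightarrow> 'a \<Rightarrow> 'a \<Rightarrow> 'a" where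
  "tree_down d T r a b = path_node T a b (tree_dist T (tree_up d T r a b) b)"

definition tree_product :: "nat \<Rightarrow> (nat \<Rightarrow> 'a pair_pre_digraph) \<Rightarrow> (nat \<Rightarrow> 'a) set" where
  "tree_product n T = (\<Pi>\<^sub>E i\<in>{1..n}. pverts (T i))"

definition componentwise ::
  "nat \<Rightarrow> (nat \<Rightarrow> 'a pair_pre_digraph) \<Rightarrow> (nat \<Rightarrow> 'a) \<Rightarrow>
   ('a pair_pre_digraph \<Rightarrow> 'a \<Rightarrow> 'a \<Rightarrow> 'a \<Rightarrow> 'a) \<Rightarrow>
   (nat \<Rightarrow> 'a) \<Rightarrow> (nat \<Rightarrow> 'a) \<Rightarrow> nat \<Rightarrow> 'a" where
  "componentwise n T r g x y = (\<lambda>i\<in>{1..n}. g (T i) (r i) (x i) (y i))"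

definition strongly_tree_submodular ::
  "nat \<Rightarrow> (nat \<Rightarrow> 'a pair_pre_digraph) \<Rightarrow> (nat \<Rightarrow> 'a) \<Rightarrow> ((nat \<Rightarrow> 'a) \<Rightarrow> real) \<Rightarrow> bool" where
  "strongly_tree_submodular n T r f \<longleftrightarrow>
     (\<forall>x\<in>tree_product n T. \<forall>y\<in>tree_product n T.
        f x + f y \<ge> f (componentwise n T r tree_sqcap x y) + f (componentwise n T r tree_sqcup x y))"

end

theory Submission
  imports Defs
begin

text \<open>
  For fixed \<open>x\<close> and \<open>y\<close> only nodes on the paths from \<open>x i\<close> to \<open>y i\<close> occur, so a point becomes a
  vector of positions on these paths, and every operation becomes arithmetic on positions and the
  position \<open>p i\<close> of the node closest to the root.

  (a) Let \<open>x'\<close> be \<open>x\<close> moved \<open>d\<close> steps towards \<open>y\<close>. Then \<open>x \<up>\<^sup>d y = x' \<and> y\<close>, and the inequality is the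
  sum of two parallelogram inequalities: the case \<open>d = 0\<close> for \<open>x'\<close> and \<open>y\<close>, whose second result \<open>w\<close>
  lies \<open>d\<close> steps beyond \<open>x \<down>\<^sub>d y\<close> (or equals \<open>y\<close> on paths shorter than \<open>d\<close>), and the inequality that moves \<open>x\<close> and \<open>w\<close> towards each other by
  \<open>d\<close> steps. Each of these telescopes over a grid of parallelograms with sides of length at most
  one, each of which follows from one or two midpoint inequalities.

  (b) Apply \<open>d = 0\<close> and then alternately \<open>d = 1\<close> and \<open>d = 0\<close> until all distances are at most one;
  the midpoints never change, and at the end the pair is \<open>x \<sqinter> y\<close>, \<open>x \<squnion> y\<close>.
\<close>

section \<open>Inequalities on vectors of positions\<close>

text \<open>
  Positions \<open>s, t\<close> are taken on a path that climbs towards the root up to position \<open>p\<close> and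
  descends afterwards, so that of two positions on the same side of \<open>p\<close> the one closer to \<open>p\<close>
  is the ancestor. In each pair of operations the two results have positions summing to
  \<open>s + t\<close>; only the first one gets a name.
\<close>

definition meet_pos :: "nat \<Rightarrow> nat \<Rightarrow> nat \<Rightarrow> nat" where
  "meet_pos p s t = max (min s t) (min p (max s t))"

definition up_pos :: "nat \<Rightarrow> nat \<Rightarrow> nat \<Rightarrow> nat \<Rightarrow> nat" where
  "up_pos d p s t = meet_pos p (if s \<le> t then min (s + d) t else max (s - d) t) t"

text \<open>An odd sum leaves two adjacent middle positions. The ancestor is the one nearer to
  \<open>p\<close>: the larger one on a climbing edge, the smaller one on a descending edge.\<close>

definition sqcap_pos :: "nat \<Rightarrow> nat \<Rightarrow> nat \<Rightarrow> nat" where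
  "sqcap_pos p s t =
     (if odd (s + t) \<and> (s + t) div 2 < p then (s + t) div 2 + 1 else (s + t) div 2)"

lemma sqcap_pos_even: "s + t = 2 * k \<Longrightarrow> sqcap_pos p s t = k"
  by (simp add: sqcap_pos_def)

lemma sqcap_pos_odd: "s + t = 2 * k + 1 \<Longrightarrow> sqcap_pos p s t = (if k < p then k + 1 else k)"
  by (simp add: sqcap_pos_def)

lemma meet_pos_le: "meet_pos p s t \<le> max s t"
  by (simp add: meet_pos_def)

lemma up_pos_le: "up_pos d p s t \<le> max s t"
  unfolding up_pos_def by (rule order.trans[OF meet_pos_le]) auto

lemma up_pos_ge: "min s t \<le> up_pos d p s t"
  unfolding up_pos_def meet_pos_def by (rule max.coboundedI1) auto

text \<open>Guarantees that the subtraction defining the second result is exact on natural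
  numbers.\<close>

lemma up_pos_le_sum: "up_pos d p s t \<le> s + t"
  using up_pos_le[of d p s t] by linarith

text \<open>\<open>g\<close> will be \<open>f\<close> composed with the map from position vectors to
  points of the product. Values of a vector outside \<open>I\<close> do not reach the point, hence
  \<open>g_cong\<close>.\<close>

locale position_box =
  fixes I :: "'i set" and g :: "('i \<Rightarrow> nat) \<Rightarrow> real"
  assumes finite_I: "finite I"
    and g_cong: "\<And>s t. (\<And>i. i \<in> I \<Longrightarrow> s i = t i) \<Longrightarrow> g s = g t"

section \<open>From midpoint inequalities to moves by \<open>d\<close> steps\<close>

locale midpoint_box = position_box I g for I :: "'i set" and g +
  fixes L p :: "'i \<Rightarrow> nat"
  assumes midpoint: "\<And>s t. (\<And>i. i \<in> I \<Longrightarrow> s i \<le> L i \<and> t i \<le> L i) \<Longrightarrow>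
      g (\<lambda>i. sqcap_pos (p i) (s i) (t i)) + g (\<lambda>i. s i + t i - sqcap_pos (p i) (s i) (t i))
        \<le> g s + g t"
begin

lemma midpoint_ineq:
  assumes "\<And>i. i \<in> I \<Longrightarrow> s i \<le> L i \<and> t i \<le> L i \<and>
    sqcap_pos (p i) (s i) (t i) = u i \<and> u i + v i = s i + t i"
  shows "g u + g v \<le> g s + g t"
proof -
  have "g (\<lambda>i. sqcap_pos (p i) (s i) (t i)) = g u"
    using assms by (intro g_cong) auto
  moreover have "g (\<lambda>i. s i + t i - sqcap_pos (p i) (s i) (t i)) = g v"
    using assms by (intro g_cong) (metis add_diff_cancel_left')
  moreover note midpoint[of s t]
  ultimately show ?thesis
    using assms by presburger
qed

text \<open>The parallelogram is cut into strips of width at most one by pulling \<open>t\<close>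
  back towards \<open>u\<close>. Where the midpoint of a strip has to be rounded, rounding towards
  the root gives the wanted corner \<open>t'\<close>, both on climbing edges, where \<open>s\<close>
  moves, and on descending edges, where it stays. So each strip costs a single midpoint
  inequality.\<close>

lemma climb_one_ineq:
  assumes "\<And>i. i \<in> I \<Longrightarrow> s i \<le> t i \<and> t i \<le> L i"
    and "\<And>i. i \<in> I \<Longrightarrow> u i = (if s i < p i \<and> s i < t i then s i + 1 else s i)"
  shows "g u + g (\<lambda>i. s i + t i - u i) \<le> g s + g t"
  using assms
proof (induction "\<Sum>i\<in>I. t i - u i" arbitrary: t rule: less_induct)
  case less
  show ?case
  proof (cases "\<forall>i\<in>I. t i = u i")
    case True
    then have "g t = g u" "g (\<lambda>i. s i + t i - u i) = g s"
      by (auto intro!: g_cong)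
    then show ?thesis by simp
  next
    case False
    define t' where "t' = (\<lambda>i. if u i < t i then t i - 1 else t i)"
    have le: "u i \<le> t i" if "i \<in> I" for i
      using less.prems that by (auto simp: Suc_le_eq)
    obtain k where k: "k \<in> I" "u k < t k"
      using False le by (metis le_neq_implies_less)
    have "(\<Sum>i\<in>I. t' i - u i) < (\<Sum>i\<in>I. t i - u i)"
      using k finite_I by (intro sum_strict_mono_ex1) (auto simp: t'_def)
    moreover have "s i \<le> t' i \<and> t' i \<le> L i" "u i = (if s i < p i \<and> s i < t' i then s i + 1 else s i)"
      if "i \<in> I" for i
      using less.prems[OF that] by (auto simp: t'_def split: if_splits)
    ultimately have 1: "g u + g (\<lambda>i. s i + t' i - u i) \<le> g s + g t'"
      by (intro less.hyps) auto
    have 2: "g t' + g (\<lambda>i. s i + t i - u i) \<le> g (\<lambda>i. s i + t' i - u i) + g t"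
    proof (rule midpoint_ineq)
      fix i assume i: "i \<in> I"
      note u = less.prems(2)[OF i]
      consider "s i < p i" "s i + 1 < t i" | "s i < p i" "t i = s i + 1"
        | "p i \<le> s i" "s i < t i" | "s i = t i"
        using less.prems(1)[OF i] by linarith
      then have "sqcap_pos (p i) (s i + t' i - u i) (t i) = t' i"
      proof cases
        case 1
        then show ?thesis by (intro sqcap_pos_even) (auto simp: t'_def u)
      next
        case 2
        then have "s i + t' i - u i + t i = 2 * s i + 1" by (auto simp: t'_def u)
        from sqcap_pos_odd[OF this] show ?thesis using 2 by (simp add: t'_def u)
      next
        case 3
        then have "s i + t' i - u i + t i = 2 * (t i - 1) + 1" by (auto simp: t'_def u)
        from sqcap_pos_odd[OF this] show ?thesis using 3 by (auto simp: t'_def u)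
      next
        case 4
        then show ?thesis by (intro sqcap_pos_even) (auto simp: t'_def u)
      qed
      then show "s i + t' i - u i \<le> L i \<and> t i \<le> L i \<and>
          sqcap_pos (p i) (s i + t' i - u i) (t i) = t' i \<and>
          t' i + (s i + t i - u i) = s i + t' i - u i + t i"
        using less.prems[OF i] by (auto simp: t'_def split: if_splits)
    qed
    from 1 2 show ?thesis by simp
  qed
qed

text \<open>For \<open>s \<le> t\<close> the formula for \<open>u\<close> is
  \<open>meet_pos\<close>. It is reached by single climbing steps, each against the far end
  \<open>t\<close> shortened by the climb that remains, so that the intermediate pairs
  cancel.\<close>

lemma climb_to_meet_ineq:
  assumes "\<And>i. i \<in> I \<Longrightarrow> s i \<le> t i \<and> t i \<le> L i"
    and "\<And>i. i \<in> I \<Longrightarrow> u i = max (s i) (min (p i) (t i))"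
  shows "g u + g (\<lambda>i. s i + t i - u i) \<le> g s + g t"
  using assms
proof (induction "\<Sum>i\<in>I. u i - s i" arbitrary: s rule: less_induct)
  case less
  show ?case
  proof (cases "\<forall>i\<in>I. u i = s i")
    case True
    then have "g u = g s" "g (\<lambda>i. s i + t i - u i) = g t"
      by (auto intro!: g_cong)
    then show ?thesis by simp
  next
    case False
    define s' where "s' = (\<lambda>i. if s i < p i \<and> s i < t i then s i + 1 else s i)"
    obtain k where k: "k \<in> I" "s k < p k" "s k < t k"
      using False less.prems by (metis max.absorb1 min.cobounded1 min.cobounded2 not_le order.trans)
    have "(\<Sum>i\<in>I. u i - s' i) < (\<Sum>i\<in>I. u i - s i)"
    proof (rule sum_strict_mono_ex1[OF finite_I])
      show "\<forall>i\<in>I. u i - s' i \<le> u i - s i" by (auto simp: s'_def)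
      show "\<exists>i\<in>I. u i - s' i < u i - s i"
        using k less.prems by (intro bexI[of _ k]) (auto simp: s'_def)
    qed
    moreover have "s' i \<le> t i \<and> t i \<le> L i" "u i = max (s' i) (min (p i) (t i))" if "i \<in> I" for i
      using less.prems[OF that] by (auto simp: s'_def)
    ultimately have 1: "g u + g (\<lambda>i. s' i + t i - u i) \<le> g s' + g t"
      by (intro less.hyps) auto
    have "g s' + g (\<lambda>i. s i + (s' i + t i - u i) - s' i) \<le> g s + g (\<lambda>i. s' i + t i - u i)"
    proof (rule climb_one_ineq, goal_cases)
      case (1 i)
      then show ?case using less.prems[OF 1]
        by (auto simp: s'_def max_def min_def split: if_splits)
    next
      case (2 i)
      then show ?case using less.prems[OF 2]
        by (auto simp: s'_def max_def min_def split: if_splits)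
    qed
    moreover have "g (\<lambda>i. s i + (s' i + t i - u i) - s' i) = g (\<lambda>i. s i + t i - u i)"
    proof (intro g_cong, goal_cases)
      case (1 i)
      then show ?case using less.prems[OF 1]
        by (auto simp: s'_def max_def min_def split: if_splits)
    qed
    ultimately show ?thesis using 1 by simp
  qed
qed

text \<open>
  In the midpoint of \<open>s\<close> and \<open>t\<close> the coordinates on a climbing edge and those on a descending
  edge are rounded in opposite directions. Hence the step from \<open>s\<close> to \<open>u\<close> is taken in two rounds
  (through \<open>w\<close>): first the coordinates that do not purely climb, then the others.
\<close>

lemma approach_small_ineq:
  assumes "\<And>i. i \<in> I \<Longrightarrow> s i \<le> t i \<and> t i \<le> L i \<and> t i \<le> s i + 2"
    and "\<And>i. i \<in> I \<Longrightarrow> u i = min (s i + 1) (t i)"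
  shows "g u + g (\<lambda>i. s i + t i - u i) \<le> g s + g t"
proof -
  define v where "v = (\<lambda>i. s i + t i - u i)"
  define w where "w = (\<lambda>i. if t i \<le> p i then s i else u i)"
  \<comment> \<open>\<open>h\<close> completes the parallelogram on \<open>s\<close>,
    \<open>w\<close> and \<open>v\<close>. The pair \<open>w\<close>, \<open>h\<close> is produced
    by the first round and consumed by the second, or conversely, and cancels in the sum.\<close>
  define h where "h = (\<lambda>i. w i + v i - s i)"
  have cases: "t i = s i \<or> t i = s i + 1 \<or> t i = s i + 2" if "i \<in> I" for i
    using assms(1)[OF that] by linarith
  have "g v + g w \<le> g s + g h"
  proof (rule midpoint_ineq)
    fix i assume i: "i \<in> I"
    show "s i \<le> L i \<and> h i \<le> L i \<and> sqcap_pos (p i) (s i) (h i) = v i \<and> v i + w i = s i + h i"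
      using cases[OF i] assms(1,2)[OF i]
      by (auto simp: h_def w_def v_def sqcap_pos_def)
  qed
  moreover have "g u + g h \<le> g w + g t"
  proof (rule midpoint_ineq)
    fix i assume i: "i \<in> I"
    show "w i \<le> L i \<and> t i \<le> L i \<and> sqcap_pos (p i) (w i) (t i) = u i \<and> u i + h i = w i + t i"
      using cases[OF i] assms(1,2)[OF i]
      by (auto simp: h_def w_def v_def sqcap_pos_def)
  qed
  ultimately show ?thesis by (simp add: v_def)
qed

text \<open>Long coordinates are reduced to distance at most two by capping \<open>t\<close> at
  \<open>s + 2 + m\<close> and raising the cap by one at a time. Each increase adds a parallelogram
  covered by \<open>approach_small_ineq\<close>.\<close>

lemma approach_one_ineq:
  assumes "\<And>i. i \<in> I \<Longrightarrow> s i \<le> t i \<and> t i \<le> L i"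
    and "\<And>i. i \<in> I \<Longrightarrow> u i = min (s i + 1) (t i)"
  shows "g u + g (\<lambda>i. s i + t i - u i) \<le> g s + g t"
proof -
  have "g u + g (\<lambda>i. s i + t i - u i) \<le> g s + g t"
    if "\<And>i. i \<in> I \<Longrightarrow> s i \<le> t i \<and> t i \<le> L i \<and> t i \<le> s i + 2 + m"
      and "\<And>i. i \<in> I \<Longrightarrow> u i = min (s i + 1) (t i)" for m t
    using that
  proof (induction m arbitrary: t)
    case 0
    then show ?case by (intro approach_small_ineq) auto
  next
    case (Suc m)
    define t' where "t' = (\<lambda>i. min (t i) (s i + 2 + m))"
    have 1: "g u + g (\<lambda>i. s i + t' i - u i) \<le> g s + g t'"
    proof (rule Suc.IH, goal_cases)
      case (1 i)
      then show ?case using Suc.prems[OF 1]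
        by (auto simp: t'_def min_def split: if_splits)
    next
      case (2 i)
      then show ?case using Suc.prems[OF 2]
        by (auto simp: t'_def min_def split: if_splits)
    qed
    have "g t' + g (\<lambda>i. s i + t' i - u i + t i - t' i) \<le> g (\<lambda>i. s i + t' i - u i) + g t"
    proof (rule approach_small_ineq)
      fix i assume i: "i \<in> I"
      show "s i + t' i - u i \<le> t i \<and> t i \<le> L i \<and> t i \<le> s i + t' i - u i + 2"
        "t' i = min (s i + t' i - u i + 1) (t i)"
        using Suc.prems[OF i] by (auto simp: t'_def min_def split: if_splits)
    qed
    moreover have "g (\<lambda>i. s i + t' i - u i + t i - t' i) = g (\<lambda>i. s i + t i - u i)"
    proof (intro g_cong, goal_cases)
      case (1 i)
      then show ?case using Suc.prems[OF 1]
        by (auto simp: t'_def min_def split: if_splits)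
    qed
    ultimately show ?case using 1 by simp
  qed
  \<comment> \<open>The induction on \<open>m\<close> needs one bound for all coordinates; the sum
    of all \<open>t i\<close> over the finite set \<open>I\<close> serves.\<close>
  moreover have "t i \<le> s i + 2 + (\<Sum>i\<in>I. t i)" if "i \<in> I" for i
    using member_le_sum[OF that _ finite_I, of t] by simp
  ultimately show ?thesis
    using assms by blast
qed

lemma approach_ineq:
  assumes "\<And>i. i \<in> I \<Longrightarrow> s i \<le> t i \<and> t i \<le> L i"
    and "\<And>i. i \<in> I \<Longrightarrow> u i = min (s i + d) (t i)"
  shows "g u + g (\<lambda>i. s i + t i - u i) \<le> g s + g t"
  using assms
proof (induction d arbitrary: s)
  case 0
  then have "g u = g s" "g (\<lambda>i. s i + t i - u i) = g t"
    by (auto intro!: g_cong)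
  then show ?case by simp
next
  case (Suc d)
  define s' where "s' = (\<lambda>i. min (s i + 1) (t i))"
  have 1: "g u + g (\<lambda>i. s' i + t i - u i) \<le> g s' + g t"
  proof (rule Suc.IH, goal_cases)
    case (1 i)
    then show ?case using Suc.prems[OF 1]
      by (auto simp: s'_def min_def split: if_splits)
  next
    case (2 i)
    then show ?case using Suc.prems[OF 2]
      by (auto simp: s'_def min_def split: if_splits)
  qed
  have "g s' + g (\<lambda>i. s i + (s' i + t i - u i) - s' i) \<le> g s + g (\<lambda>i. s' i + t i - u i)"
  proof (rule approach_one_ineq, goal_cases)
    case (1 i)
    then show ?case using Suc.prems[OF 1]
      by (auto simp: s'_def min_def split: if_splits)
  next
    case (2 i)
    then show ?case using Suc.prems[OF 2]
      by (auto simp: s'_def min_def split: if_splits)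
  qed
  moreover have "g (\<lambda>i. s i + (s' i + t i - u i) - s' i) = g (\<lambda>i. s i + t i - u i)"
  proof (intro g_cong, goal_cases)
    case (1 i)
    then show ?case using Suc.prems[OF 1]
      by (auto simp: s'_def min_def split: if_splits)
  qed
  ultimately show ?case using 1 by simp
qed

lemma up_ineq:
  assumes "\<And>i. i \<in> I \<Longrightarrow> s i \<le> t i \<and> t i \<le> L i"
    and "\<And>i. i \<in> I \<Longrightarrow> u i = up_pos d (p i) (s i) (t i)"
  shows "g u + g (\<lambda>i. s i + t i - u i) \<le> g s + g t"
proof -
  define s' where "s' = (\<lambda>i. min (s i + d) (t i))"
  have u: "u i = max (s' i) (min (p i) (t i))" if "i \<in> I" for i
    using assms[OF that] by (auto simp: up_pos_def meet_pos_def s'_def)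
  have 1: "g u + g (\<lambda>i. s' i + t i - u i) \<le> g s' + g t"
  proof (rule climb_to_meet_ineq, goal_cases)
    case (1 i)
    then show ?case using assms[OF 1] u[OF 1]
      by (auto simp: s'_def min_def split: if_splits)
  next
    case (2 i)
    then show ?case using assms[OF 2] u[OF 2]
      by (auto simp: s'_def min_def split: if_splits)
  qed
  \<comment> \<open>The far end is now \<open>s' + t - u\<close>, which is never before
    \<open>s'\<close> because \<open>u \<le> t\<close>. Where \<open>s'\<close> was capped at
    \<open>t\<close>, also \<open>u = t\<close> and the far end is \<open>t\<close> itself, so
    \<open>d\<close> steps from \<open>s\<close> still end at \<open>s'\<close>.\<close>
  have "g s' + g (\<lambda>i. s i + (s' i + t i - u i) - s' i) \<le> g s + g (\<lambda>i. s' i + t i - u i)"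
  proof (rule approach_ineq[where d = d], goal_cases)
    case (1 i)
    then show ?case using assms[OF 1] u[OF 1]
      by (auto simp: s'_def min_def max_def split: if_splits)
  next
    case (2 i)
    then show ?case using assms[OF 2] u[OF 2]
      by (auto simp: s'_def min_def max_def split: if_splits)
  qed
  moreover have "g (\<lambda>i. s i + (s' i + t i - u i) - s' i) = g (\<lambda>i. s i + t i - u i)"
  proof (intro g_cong, goal_cases)
    case (1 i)
    then show ?case using assms[OF 1] u[OF 1]
      by (auto simp: s'_def min_def max_def split: if_splits)
  qed
  ultimately show ?thesis using 1 by simp
qed

end

section \<open>From moves by \<open>d\<close> steps back to midpoints\<close>

locale up_box = position_box I g for I :: "'i set" and g +
  fixes L p :: "'i \<Rightarrow> nat"
  assumes up: "\<And>s t d. (\<And>i. i \<in> I \<Longrightarrow> s i \<le> L i \<and> t i \<le> L i) \<Longrightarrow>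
      g (\<lambda>i. up_pos d (p i) (s i) (t i)) + g (\<lambda>i. s i + t i - up_pos d (p i) (s i) (t i))
        \<le> g s + g t"
begin

lemma up_ineq:
  assumes "\<And>i. i \<in> I \<Longrightarrow> s i \<le> L i \<and> t i \<le> L i \<and>
    up_pos d (p i) (s i) (t i) = u i \<and> u i + v i = s i + t i"
  shows "g u + g v \<le> g s + g t"
proof -
  have "g (\<lambda>i. up_pos d (p i) (s i) (t i)) = g u"
    using assms by (intro g_cong) auto
  moreover have "g (\<lambda>i. s i + t i - up_pos d (p i) (s i) (t i)) = g v"
    using assms by (intro g_cong) (metis add_diff_cancel_left')
  moreover note up[of s t d]
  ultimately show ?thesis
    using assms by presburger
qed

text \<open>
  For ordered pairs \<open>d = 1\<close> moves the ends one step towards each other where their distance is at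
  least two, but swaps neighbours; \<open>d = 0\<close> swaps them back. The sum of the positions, hence the
  midpoint, is unchanged.
\<close>

lemma midpoint_ordered_ineq:
  assumes "\<And>i. i \<in> I \<Longrightarrow> s i \<le> L i \<and> t i \<le> L i \<and> (p i \<le> s i \<and> s i \<le> t i \<or> t i \<le> s i \<and> s i \<le> p i)"
  shows "g (\<lambda>i. sqcap_pos (p i) (s i) (t i)) + g (\<lambda>i. s i + t i - sqcap_pos (p i) (s i) (t i))
    \<le> g s + g t"
  using assms
proof (induction "\<Sum>i\<in>I. max (s i) (t i) - min (s i) (t i)" arbitrary: s t rule: less_induct)
  case less
  show ?case
  proof (cases "\<forall>i\<in>I. s i \<le> t i + 1 \<and> t i \<le> s i + 1")
    case True
    \<comment> \<open>For an ordered pair \<open>s\<close> is the ancestor, so at distance at most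
      one the pair already is its own pair of middle nodes.\<close>
    have "sqcap_pos (p i) (s i) (t i) = s i" if i: "i \<in> I" for i
    proof -
      have "t i = s i \<or> t i = s i + 1 \<or> s i = t i + 1" using True i by force
      then show ?thesis using less.prems[OF i] by (auto simp: sqcap_pos_def)
    qed
    then have "g (\<lambda>i. sqcap_pos (p i) (s i) (t i)) = g s"
      "g (\<lambda>i. s i + t i - sqcap_pos (p i) (s i) (t i)) = g t"
      by (auto intro!: g_cong)
    then show ?thesis by simp
  next
    case False
    define s1 where "s1 = (\<lambda>i. up_pos 1 (p i) (s i) (t i))"
    define t1 where "t1 = (\<lambda>i. s i + t i - s1 i)"
    define s2 where "s2 = (\<lambda>i. if s i + 2 \<le> t i then s i + 1 else if t i + 2 \<le> s i then s i - 1 else s i)"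
    define t2 where "t2 = (\<lambda>i. s i + t i - s2 i)"
    have s1: "s1 i = (if s i < t i then s i + 1 else if t i < s i then s i - 1 else s i)" if "i \<in> I" for i
      using less.prems[OF that] by (auto simp: s1_def up_pos_def meet_pos_def)
    have 1: "g s1 + g t1 \<le> g s + g t"
    proof (rule up_ineq[where d = 1], goal_cases)
      case (1 i)
      then show ?case using less.prems[OF 1] up_pos_le_sum
        by (auto simp: s1_def t1_def split: if_splits)
    qed
    have 2: "g s2 + g t2 \<le> g s1 + g t1"
    proof (rule up_ineq[where d = 0])
      fix i assume i: "i \<in> I"
      show "s1 i \<le> L i \<and> t1 i \<le> L i \<and> up_pos 0 (p i) (s1 i) (t1 i) = s2 i \<and> s2 i + t2 i = s1 i + t1 i"
      proof -
        consider "p i \<le> s i" "s i + 2 \<le> t i" | "p i \<le> s i" "t i = s i + 1" | "t i = s i"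
          | "s i \<le> p i" "s i = t i + 1" | "s i \<le> p i" "t i + 2 \<le> s i"
          using less.prems[OF i] by linarith
        then show ?thesis
          using less.prems[OF i] s1[OF i]
          by cases (auto simp: t1_def s2_def t2_def up_pos_def meet_pos_def)
      qed
    qed
    have sum: "s2 i + t2 i = s i + t i" for i
      by (auto simp: s2_def t2_def)
    then have sqcap: "sqcap_pos (p i) (s2 i) (t2 i) = sqcap_pos (p i) (s i) (t i)" for i
      by (simp add: sqcap_pos_def)
    obtain k where k: "k \<in> I" "\<not> (s k \<le> t k + 1 \<and> t k \<le> s k + 1)"
      using False by blast
    have "(\<Sum>i\<in>I. max (s2 i) (t2 i) - min (s2 i) (t2 i)) < (\<Sum>i\<in>I. max (s i) (t i) - min (s i) (t i))"
    proof (rule sum_strict_mono_ex1[OF finite_I])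
      show "\<forall>i\<in>I. max (s2 i) (t2 i) - min (s2 i) (t2 i) \<le> max (s i) (t i) - min (s i) (t i)"
        by (auto simp: s2_def t2_def)
      show "\<exists>i\<in>I. max (s2 i) (t2 i) - min (s2 i) (t2 i) < max (s i) (t i) - min (s i) (t i)"
        \<comment> \<open>Only coordinates at distance at least two shrink, and \<open>k\<close> is
          one of them; neighbours have been swapped twice.\<close>
        using k by (intro bexI[of _ k]) (auto simp: s2_def t2_def)
    qed
    moreover have "s2 i \<le> L i \<and> t2 i \<le> L i \<and>
        (p i \<le> s2 i \<and> s2 i \<le> t2 i \<or> t2 i \<le> s2 i \<and> s2 i \<le> p i)" if "i \<in> I" for i
      using less.prems[OF that] by (auto simp: s2_def t2_def)
    ultimately have "g (\<lambda>i. sqcap_pos (p i) (s2 i) (t2 i)) +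
        g (\<lambda>i. s2 i + t2 i - sqcap_pos (p i) (s2 i) (t2 i)) \<le> g s2 + g t2"
      by (rule less.hyps)
    with 1 2 show ?thesis by (simp add: sqcap sum)
  qed
qed

text \<open>The case \<open>d = 0\<close> makes an arbitrary pair ordered: \<open>u\<close> is
  \<open>p\<close> clamped between the two ends, hence an ancestor of \<open>v\<close>. The sum of
  the positions, and with it the midpoint, is kept.\<close>

lemma midpoint_ineq:
  assumes "\<And>i. i \<in> I \<Longrightarrow> s i \<le> L i \<and> t i \<le> L i"
  shows "g (\<lambda>i. sqcap_pos (p i) (s i) (t i)) + g (\<lambda>i. s i + t i - sqcap_pos (p i) (s i) (t i))
    \<le> g s + g t"
proof -
  define u where "u = (\<lambda>i. up_pos 0 (p i) (s i) (t i))"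
  define v where "v = (\<lambda>i. s i + t i - u i)"
  have sum: "u i + v i = s i + t i" for i
    using up_pos_le_sum[of 0 "p i" "s i" "t i"] by (simp add: u_def v_def)
  then have sqcap: "sqcap_pos (p i) (u i) (v i) = sqcap_pos (p i) (s i) (t i)" for i
    by (simp add: sqcap_pos_def)
  have "g u + g v \<le> g s + g t"
    using up[of s t 0] assms by (simp add: u_def v_def)
  moreover have "g (\<lambda>i. sqcap_pos (p i) (u i) (v i)) + g (\<lambda>i. u i + v i - sqcap_pos (p i) (u i) (v i))
      \<le> g u + g v"
  proof (rule midpoint_ordered_ineq, goal_cases)
    case (1 i)
    then show ?case using assms[OF 1]
      by (auto simp: u_def v_def up_pos_def meet_pos_def min_def max_def split: if_splits)
  qed
  ultimately show ?thesis by (simp add: sqcap sum)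
qed

end

section \<open>Paths in rooted trees\<close>

lemma drop_nth_mem_iff:
  assumes "distinct xs" "k < length xs"
  shows "xs ! k \<in> set (drop j xs) \<longleftrightarrow> j \<le> k"
proof
  assume "xs ! k \<in> set (drop j xs)"
  then obtain m where "m < length xs - j" "xs ! k = xs ! (j + m)"
    by (auto simp: in_set_conv_nth)
  then show "j \<le> k"
    using assms by (simp add: nth_eq_iff_index_eq less_diff_conv)
next
  assume "j \<le> k"
  then have "drop j xs ! (k - j) = xs ! k" "k - j < length (drop j xs)"
    using assms by simp_all
  then show "xs ! k \<in> set (drop j xs)"
    by (metis nth_mem)
qed

lemma vpath_infix:
  assumes "vpath (xs @ ys @ zs) G" "ys \<noteq> []"
  shows "vpath ys G"
  using assms by (auto simp: vpath_def intro: vwalkI_append_l[of ys zs] vwalkI_append_r[of _ xs])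

lemma vpath_drop: "vpath xs G \<Longrightarrow> j < length xs \<Longrightarrow> vpath (drop j xs) G"
  using vpath_infix[of "take j xs" "drop j xs" "[]"] by simp

lemma vpath_take: "vpath xs G \<Longrightarrow> xs \<noteq> [] \<Longrightarrow> 0 < j \<Longrightarrow> vpath (take j xs) G"
  using vpath_infix[of "[]" "take j xs" "drop j xs"] by simp

section \<open>Unique paths and ancestors along a path\<close>

locale rooted_tree_graph = pair_graph T for T :: "'a pair_pre_digraph" +
  fixes r :: 'a
  assumes rooted_tree: "rooted_tree T r"
begin

lemma root_in_verts: "r \<in> pverts T"
  using rooted_tree by (simp add: rooted_tree_def)

lemma vpath_rev: "vpath xs T \<Longrightarrow> vpath (rev xs) T"
  by (auto simp: vpath_def intro: vwalk_rev_ex sym_arcs)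

text \<open>Cycles are defined through lists of arcs, paths through lists of vertices; this connects
  the two.\<close>

lemma awalk_vwalk_arcs:
  assumes "vwalk c T"
  shows "awalk (hd c) (vwalk_arcs c) (last c) \<and> awalk_verts (hd c) (vwalk_arcs c) = c"
  using assms
  by (induction c rule: vwalk_arcs.induct) (auto simp: awalk_simps)

text \<open>Four entries, the first repeated at the end, mean three arcs, the least length of a
  cycle that \<open>rooted_tree\<close> forbids.\<close>

lemma no_long_closed_vwalk:
  assumes "vwalk c T" "hd c = last c" "distinct (tl c)" "4 \<le> length c"
  shows False
proof -
  have "awalk (hd c) (vwalk_arcs c) (hd c)" "awalk_verts (hd c) (vwalk_arcs c) = c"
    using awalk_vwalk_arcs[OF assms(1)] assms(2) by auto
  moreover have len: "3 \<le> length (vwalk_arcs c)"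
    using assms(4) vwalk_length_simp[of c] unfolding vwalk_length_def by linarith
  moreover from len have "vwalk_arcs c \<noteq> []" by auto
  ultimately have "cycle (vwalk_arcs c)"
    unfolding cycle_def using assms(3) by auto
  with len rooted_tree show False
    by (auto simp: rooted_tree_def)
qed

text \<open>Common first vertices are stripped off by induction. Where two paths with the same ends
  first diverge, following them to a common vertex would close a cycle.\<close>

lemma vpath_unique:
  assumes "vpath p T" "vpath q T" "hd p = hd q" "last p = last q"
  shows "p = q"
  using assms
proof (induction p arbitrary: q)
  case Nil
  then show ?case by (simp add: vpath_def vwalk_def)
next
  case (Cons a p)
  then obtain q' where q: "q = a # q'"
    by (cases q) (auto simp: vpath_def vwalk_def)
  show ?case
  proof (cases "p = [] \<or> q' = []")
    case True
    then show ?thesis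
      using Cons.prems by (auto simp: q vpath_def split: if_splits)
  next
    case False
    then have paths: "vpath p T" "vpath q' T" "last p = last q'"
      using Cons.prems vpath_infix[of "[a]" p "[]"] vpath_infix[of "[a]" q' "[]"] by (auto simp: q)
    show ?thesis
    proof (cases "hd p = hd q'")
      case True
      then show ?thesis using Cons.IH[OF paths(1,2) _ paths(3)] q by simp
    next
      case hd_neq: False
      have "\<exists>z\<in>set p. z \<in> set q'"
        using False paths(3) by (metis last_in_set)
      then obtain p1 z p2 where p: "p = p1 @ z # p2" "z \<in> set q'" "\<forall>w\<in>set p1. w \<notin> set q'"
        using split_list_first_prop[of p "\<lambda>z. z \<in> set q'"] by blast
      then obtain q1 q2 where q': "q' = q1 @ z # q2"
        by (meson split_list)
      \<comment> \<open>Out along \<open>p\<close> to the first common node, back along \<open>q\<close>.\<close>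
      define c where "c = (a # p1 @ [z]) \<oplus> rev (a # q1 @ [z])"
      have c: "c = a # p1 @ z # rev q1 @ [a]"
        by (simp add: c_def vwalk_join_def)
      have "vwalk (a # p1 @ [z]) T" "vwalk (a # q1 @ [z]) T"
        using Cons.prems(1,2) vwalkI_append_l[of "a # p1 @ [z]" p2] vwalkI_append_l[of "a # q1 @ [z]" q2]
        by (auto simp: vpath_def p q q')
      then have "vwalk c T"
        unfolding c_def by (intro vwalk_joinI_vwalk' vwalk_rev_ex sym_arcs) auto
      moreover have "distinct (tl c)"
        using Cons.prems(1,2) p(3) by (auto simp: vpath_def p(1) q q' c)
      \<comment> \<open>If both were empty, \<open>z\<close> would be the second vertex of both
        paths.\<close>
      moreover have "p1 \<noteq> [] \<or> q1 \<noteq> []"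
        using hd_neq by (auto simp: p q')
      then have "4 \<le> length c"
        by (cases p1; cases q1) (auto simp: c)
      ultimately have False
        by (intro no_long_closed_vwalk[of c]) (auto simp: c)
      then show ?thesis ..
    qed
  qed
qed

lemma tree_path_hd_last:
  assumes "vpath xs T"
  shows "tree_path T (hd xs) (last xs) = xs"
  unfolding tree_path_def
  by (rule the_equality) (use assms vpath_unique in blast)+

lemma tree_path:
  assumes "a \<in> pverts T" "b \<in> pverts T"
  shows "vpath (tree_path T a b) T" "hd (tree_path T a b) = a" "last (tree_path T a b) = b"
proof -
  have "strongly_connected T"
    using rooted_tree sym_arcs
    by (intro symmetric_connected_imp_strongly_connected) (auto simp: rooted_tree_def)
  then have "a \<rightarrow>\<^sup>*\<^bsub>T\<^esub> b"
    using assms by (auto simp: strongly_connected_def)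
  then obtain xs where "vpath xs T" "hd xs = a" "last xs = b"
    unfolding reachable_vpath_conv by blast
  then show "vpath (tree_path T a b) T" "hd (tree_path T a b) = a" "last (tree_path T a b) = b"
    using tree_path_hd_last[of xs] by auto
qed

lemma tree_path_nth:
  assumes "vpath xs T" "i \<le> j" "j < length xs"
  shows "tree_path T (xs ! i) (xs ! j) = take (j - i + 1) (drop i xs)"
    and "tree_path T (xs ! j) (xs ! i) = rev (take (j - i + 1) (drop i xs))"
proof -
  let ?ys = "take (j - i + 1) (drop i xs)"
  have ys: "vpath ?ys T"
    using assms by (intro vpath_take vpath_drop) auto
  moreover have "hd ?ys = xs ! i" "last ?ys = xs ! j"
    using assms by (simp_all add: hd_drop_conv_nth last_conv_nth hd_conv_nth)
  ultimately show "tree_path T (xs ! i) (xs ! j) = ?ys"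
    using tree_path_hd_last by metis
  show "tree_path T (xs ! j) (xs ! i) = rev ?ys"
    using tree_path_hd_last[OF vpath_rev[OF ys]] \<open>hd ?ys = xs ! i\<close> \<open>last ?ys = xs ! j\<close>
    by (simp add: hd_rev last_rev)
qed

lemma ancestor_nth_iff:
  assumes "vpath xs T" "last xs = r" "j < length xs"
  shows "ancestor T r c (xs ! j) \<longleftrightarrow> c \<in> set (drop j xs)"
  using tree_path_hd_last[OF vpath_drop[OF assms(1,3)]] assms
  by (simp add: ancestor_def hd_drop_conv_nth)

lemma path_node_in_verts:
  assumes "a \<in> pverts T" "b \<in> pverts T"
  shows "path_node T a b i \<in> pverts T"
proof (cases "i \<le> tree_dist T a b")
  case True
  then have "tree_path T a b ! i \<in> set (tree_path T a b)"
    using tree_path(1)[OF assms]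
    by (intro nth_mem) (cases "tree_path T a b"; auto simp: tree_dist_def vpath_def vwalk_def)
  with True show ?thesis
    using tree_path(1)[OF assms] by (auto simp: path_node_def vpath_def vwalk_def)
qed (simp add: path_node_def assms)

text \<open>The turning point is the last vertex \<open>c\<close> on the path \<open>Q\<close> from
  \<open>a\<close> to \<open>b\<close> that also lies on the path \<open>R\<close> from
  \<open>a\<close> to the root. Up to \<open>c\<close> the two paths agree; after \<open>c\<close>,
  the path from \<open>b\<close> to the root runs back along \<open>Q\<close> to \<open>c\<close>
  and then follows \<open>R\<close>. Ancestors are read off from these two root paths.\<close>

lemma ex_turning_position:
  assumes "a \<in> pverts T" "b \<in> pverts T"
  shows "\<exists>p. \<forall>i\<le>tree_dist T a b. \<forall>j\<le>tree_dist T a b.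
    ancestor T r (path_node T a b i) (path_node T a b j) \<longleftrightarrow> j \<le> i \<and> i \<le> p \<or> p \<le> i \<and> i \<le> j"
proof -
  define Q where "Q = tree_path T a b"
  define R where "R = tree_path T a r"
  have Q: "vpath Q T" "hd Q = a" "last Q = b"
    unfolding Q_def by (rule tree_path[OF assms])+
  have R: "vpath R T" "hd R = a" "last R = r"
    unfolding R_def by (rule tree_path[OF assms(1) root_in_verts])+
  have "Q \<noteq> []" "R \<noteq> []"
    using Q(1) R(1) by (auto simp: vpath_def vwalk_def)
  then have "\<exists>z\<in>set Q. z \<in> set R"
    using Q(2) R(2) by (metis hd_in_set)
  then obtain ys c zs where Q_eq: "Q = ys @ c # zs" and "c \<in> set R" and zs: "\<forall>z\<in>set zs. z \<notin> set R"
    using split_list_last_prop[of Q "\<lambda>z. z \<in> set R"] by blast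
  then obtain us ws where "R = us @ c # ws"
    by (meson split_list)
  moreover have "us @ [c] = ys @ [c]"
  proof (rule vpath_unique)
    show "vpath (us @ [c]) T" "vpath (ys @ [c]) T"
      using Q(1) R(1) vpath_infix[of "[]" "us @ [c]" ws] vpath_infix[of "[]" "ys @ [c]" zs]
      by (auto simp: Q_eq calculation)
    show "hd (us @ [c]) = hd (ys @ [c])"
      using Q(2) R(2) by (cases us; cases ys) (auto simp: Q_eq calculation)
  qed auto
  ultimately have R_eq: "R = ys @ c # ws" by simp
  \<comment> \<open>The path from \<open>b\<close> to the root: the descending part of
    \<open>Q\<close> reversed, then the rest of \<open>R\<close>.\<close>
  define S where "S = rev zs @ c # ws"
  have "vpath (c # zs) T" "vpath (c # ws) T"
    using vpath_infix[of ys "c # zs" "[]" T] vpath_infix[of ys "c # ws" "[]" T] Q(1) R(1)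
    by (simp_all add: Q_eq R_eq)
  then have "vwalk (rev (c # zs) \<oplus> (c # ws)) T"
    using vpath_rev[of "c # zs"] by (intro vwalk_joinI_vwalk') (auto simp: vpath_def)
  moreover have "distinct S"
    using Q(1) R(1) zs by (auto simp: S_def Q_eq R_eq vpath_def)
  ultimately have S: "vpath S T" "last S = r"
    using R(3) by (auto simp: S_def R_eq vpath_def vwalk_join_def)
  let ?p = "length ys" and ?L = "tree_dist T a b"
  have L: "?L = length ys + length zs"
    by (simp add: tree_dist_def Q_def[symmetric] Q_eq)
  have "ancestor T r (Q ! i) (Q ! j) \<longleftrightarrow> j \<le> i \<and> i \<le> ?p \<or> ?p \<le> i \<and> i \<le> j"
    if ij: "i \<le> ?L" "j \<le> ?L" for i j
  proof (cases "j \<le> ?p")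
    case True
    have QR: "Q ! k = R ! k" if "k \<le> ?p" for k
      using that by (auto simp: Q_eq R_eq nth_append)
    have anc: "ancestor T r (Q ! i) (Q ! j) \<longleftrightarrow> Q ! i \<in> set (drop j R)"
      using ancestor_nth_iff[OF R(1,3), of j] True QR[OF True] by (simp add: R_eq)
    show ?thesis
    proof (cases "i \<le> ?p")
      case i: True
      have "R ! i \<in> set (drop j R) \<longleftrightarrow> j \<le> i"
        using R(1) i by (intro drop_nth_mem_iff) (auto simp: vpath_def R_eq)
      then show ?thesis using anc QR[OF i] i True by auto
    next
      case False
      then have "Q ! i = zs ! (i - ?p - 1)" "i - ?p - 1 < length zs"
        using ij by (auto simp: Q_eq nth_append nth_Cons' L)
      then have "Q ! i \<notin> set R" using zs by simp
      then show ?thesis using anc False True by (auto dest: in_set_dropD)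
    qed
  next
    case False
    have QS: "Q ! k = S ! (?L - k)" if "?p \<le> k" "k \<le> ?L" for k
      using that by (auto simp: Q_eq S_def nth_append L rev_nth nth_Cons' intro!: arg_cong[of _ _ "nth zs"])
    have anc: "ancestor T r (Q ! i) (Q ! j) \<longleftrightarrow> Q ! i \<in> set (drop (?L - j) S)"
      using ancestor_nth_iff[OF S, of "?L - j"] False QS[of j] ij by (auto simp: S_def L)
    show ?thesis
    proof (cases "?p \<le> i")
      case i: True
      have "S ! (?L - i) \<in> set (drop (?L - j) S) \<longleftrightarrow> ?L - j \<le> ?L - i"
        using S(1) i ij by (intro drop_nth_mem_iff) (auto simp: vpath_def S_def L)
      then show ?thesis using anc QS[of i] i ij False by auto
    next
      case i: False
      then have "Q ! i \<in> set ys" by (auto simp: Q_eq nth_append)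
      then have "Q ! i \<notin> set S" using Q(1) R(1) by (auto simp: S_def Q_eq R_eq vpath_def)
      then show ?thesis using anc False i by (auto dest: in_set_dropD)
    qed
  qed
  then show ?thesis
    by (intro exI[of _ ?p]) (auto simp: path_node_def Q_def)
qed

end

section \<open>Tree operations as arithmetic on positions\<close>

locale tree_segment = rooted_tree_graph +
  fixes a b :: 'a and p :: nat
  assumes ends_in_verts: "a \<in> pverts T" "b \<in> pverts T"
    and ancestor_iff: "\<And>i j. i \<le> tree_dist T a b \<Longrightarrow> j \<le> tree_dist T a b \<Longrightarrow>
      ancestor T r (path_node T a b i) (path_node T a b j) \<longleftrightarrow> j \<le> i \<and> i \<le> p \<or> p \<le> i \<and> i \<le> j"
begin

abbreviation len :: nat where "len \<equiv> tree_dist T a b"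
abbreviation pos :: "nat \<Rightarrow> 'a" where "pos \<equiv> path_node T a b"

lemma vpath_ab: "vpath (tree_path T a b) T"
  by (rule tree_path(1)[OF ends_in_verts])

lemma length_tree_path: "length (tree_path T a b) = len + 1"
  using vpath_ab by (cases "tree_path T a b") (auto simp: tree_dist_def vpath_def vwalk_def)

lemma pos_nth: "i \<le> len \<Longrightarrow> pos i = tree_path T a b ! i"
  by (simp add: path_node_def)

lemma pos_0: "pos 0 = a"
  using tree_path(2)[OF ends_in_verts] length_tree_path
  by (cases "tree_path T a b") (auto simp: pos_nth)

lemma pos_len: "pos len = b"
proof -
  have "tree_path T a b \<noteq> []" using length_tree_path by auto
  then show ?thesis
    using tree_path(3)[OF ends_in_verts] length_tree_path by (simp add: pos_nth last_conv_nth)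
qed

lemma tree_path_pos:
  assumes "i \<le> len" "j \<le> len"
  shows "tree_path T (pos i) (pos j) =
    map pos (if i \<le> j then [i..<Suc j] else rev [j..<Suc i])"
proof -
  have *: "take (j - i + 1) (drop i (tree_path T a b)) = map pos [i..<Suc j]" if "i \<le> j" "j \<le> len" for i j
    using that length_tree_path by (intro nth_equalityI) (auto simp: pos_nth simp del: upt_Suc)
  show ?thesis
    using tree_path_nth[OF vpath_ab, of i j] tree_path_nth[OF vpath_ab, of j i] assms
      length_tree_path *[of i j] *[of j i]
    by (auto simp: pos_nth rev_map)
qed

lemma tree_dist_pos:
  assumes "i \<le> len" "j \<le> len"
  shows "tree_dist T (pos i) (pos j) = (if i \<le> j then j - i else i - j)"
  using assms by (simp add: tree_dist_def tree_path_pos)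

lemma path_node_pos:
  assumes "i \<le> len" "j \<le> len"
  shows "path_node T (pos i) (pos j) d = pos (if i \<le> j then min (i + d) j else max (i - d) j)"
proof (cases "i \<le> j")
  case True
  then have "[i..<Suc j] ! d = i + d" if "d \<le> j - i"
    using that by (intro nth_upt) auto
  then show ?thesis
    using assms True
    by (auto simp: path_node_def[of T "pos i"] tree_dist_pos tree_path_pos min_def simp del: upt_Suc)
next
  case False
  then have "rev [j..<Suc i] ! d = i - d" if "d \<le> i - j"
    using that by (subst rev_nth) (auto simp del: upt_Suc)
  then show ?thesis
    using assms False
    by (auto simp: path_node_def[of T "pos i"] tree_dist_pos tree_path_pos max_def simp del: upt_Suc
        intro!: arg_cong[of _ _ pos])
qed

lemma tree_meet_pos:
  assumes "i \<le> len" "j \<le> len"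
  shows "tree_meet T r (pos i) (pos j) = pos (meet_pos p i j)"
proof -
  have set: "set (tree_path T (pos i) (pos j)) = pos ` {min i j..max i j}"
    using assms by (auto simp: tree_path_pos simp del: upt_Suc)
  have bd: "min i j \<le> meet_pos p i j" "meet_pos p i j \<le> max i j"
    by (simp_all add: meet_pos_def)
  \<comment> \<open>Between \<open>i\<close> and \<open>j\<close>, being an ancestor of both ends
    forces the position to be \<open>p\<close> clamped to that interval.\<close>
  have key: "(i \<le> k \<and> k \<le> p \<or> p \<le> k \<and> k \<le> i) \<and> (j \<le> k \<and> k \<le> p \<or> p \<le> k \<and> k \<le> j)
      \<longleftrightarrow> k = meet_pos p i j" if "min i j \<le> k" "k \<le> max i j" for k
    using that by (cases "i \<le> j"; cases "p \<le> i"; cases "p \<le> j") (auto simp: meet_pos_def)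
  show ?thesis
    unfolding tree_meet_def
  proof (rule the_equality)
    show "pos (meet_pos p i j) \<in> set (tree_path T (pos i) (pos j)) \<and>
      ancestor T r (pos (meet_pos p i j)) (pos i) \<and> ancestor T r (pos (meet_pos p i j)) (pos j)"
      using bd key[of "meet_pos p i j"] assms by (auto simp: set ancestor_iff)
  next
    fix c assume c: "c \<in> set (tree_path T (pos i) (pos j)) \<and> ancestor T r c (pos i) \<and> ancestor T r c (pos j)"
    then obtain k where k: "c = pos k" "min i j \<le> k" "k \<le> max i j"
      unfolding set by auto
    then have "k \<le> len" using assms by simp
    then show "c = pos (meet_pos p i j)"
      using c key[OF k(2,3)] assms by (simp add: k(1) ancestor_iff)
  qed
qed

text \<open>Halving the distance from either end gives the same two positions \<open>m\<close> and
  \<open>i + j - m\<close>, in one order or the other. If they differ they are adjacent, and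
  comparing \<open>m\<close> with \<open>p\<close> decides which is the ancestor.\<close>

lemma mid_pair_pos:
  assumes "i \<le> len" "j \<le> len"
  shows "mid_pair T r (pos i) (pos j) = (pos (sqcap_pos p i j), pos (i + j - sqcap_pos p i j))"
proof -
  define m where "m = (i + j) div 2"
  have nodes: "{path_node T (pos i) (pos j) (tree_dist T (pos i) (pos j) div 2),
      path_node T (pos i) (pos j) ((tree_dist T (pos i) (pos j) + 1) div 2)} = {pos m, pos (i + j - m)}"
  proof (cases "i \<le> j")
    case True
    then obtain k where k: "j = i + k" by (auto simp: le_iff_add)
    have "m = i + k div 2" by (simp add: m_def k)
    moreover have "k = k div 2 + (k + 1) div 2" by presburger
    ultimately have "i + k div 2 = m" "i + (k + 1) div 2 = i + j - m" "m \<le> j" "i + j - m \<le> j"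
      unfolding k by linarith+
    then show ?thesis
      using assms True by (simp add: path_node_pos tree_dist_pos k)
  next
    case False
    then obtain k where k: "i = j + k" by (metis le_add_diff_inverse nat_le_linear)
    have "m = j + k div 2" by (simp add: m_def k)
    moreover have "k = k div 2 + (k + 1) div 2" by presburger
    ultimately have "i - k div 2 = i + j - m" "i - (k + 1) div 2 = m" "j \<le> m" "j \<le> i + j - m"
      unfolding k by linarith+
    then show ?thesis
      using assms False by (simp add: path_node_pos tree_dist_pos k insert_commute)
  qed
  have m_le: "m \<le> len" using assms by (simp add: m_def)
  show ?thesis
  proof (cases "even (i + j)")
    case True
    then have "i + j = 2 * m" by (simp add: m_def)
    then have "sqcap_pos p i j = m" "i + j - m = m"
      by (simp_all add: sqcap_pos_even)
    then show ?thesis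
      unfolding mid_pair_def nodes using m_le
      by (intro the_equality) (auto simp: ancestor_iff)
  next
    case False
    then have sum: "i + j = 2 * m + 1" by (simp add: m_def)
    then have m1: "i + j - m = m + 1" "m + 1 \<le> len"
      using assms by auto
    have "sqcap_pos p i j = (if m < p then m + 1 else m)"
      using sum by (rule sqcap_pos_odd)
    then show ?thesis
      unfolding mid_pair_def nodes m1(1) using m_le m1 sum
      by (intro the_equality) (auto simp: ancestor_iff doubleton_eq_iff split: if_splits)
  qed
qed

lemma tree_sqcap_pos:
  "i \<le> len \<Longrightarrow> j \<le> len \<Longrightarrow> tree_sqcap T r (pos i) (pos j) = pos (sqcap_pos p i j)"
  by (simp add: tree_sqcap_def mid_pair_pos)

lemma tree_sqcup_pos:
  "i \<le> len \<Longrightarrow> j \<le> len \<Longrightarrow> tree_sqcup T r (pos i) (pos j) = pos (i + j - sqcap_pos p i j)"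
  by (simp add: tree_sqcup_def mid_pair_pos)

lemma tree_up_pos:
  assumes "i \<le> len" "j \<le> len"
  shows "tree_up d T r (pos i) (pos j) = pos (up_pos d p i j)"
  using assms by (simp add: tree_up_def path_node_pos up_pos_def tree_meet_pos)

text \<open>As \<open>up_pos\<close> lies between \<open>i\<close> and \<open>j\<close>, its
  distance to \<open>j\<close> is at most that of \<open>i\<close>; walking this far from
  \<open>i\<close> is never cut off at \<open>j\<close>.\<close>

lemma tree_down_pos:
  assumes "i \<le> len" "j \<le> len"
  shows "tree_down d T r (pos i) (pos j) = pos (i + j - up_pos d p i j)"
proof -
  have "up_pos d p i j \<le> max i j" by (rule up_pos_le)
  moreover have "min i j \<le> up_pos d p i j" by (rule up_pos_ge)
  ultimately show ?thesis
    using assms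
    by (cases "i \<le> j") (auto simp: tree_down_def tree_up_pos tree_dist_pos path_node_pos
        intro!: arg_cong[of _ _ pos])
qed

end

lemma ex_tree_segment:
  assumes "rooted_tree T r" "a \<in> pverts T" "b \<in> pverts T"
  shows "\<exists>p. tree_segment T r a b p"
proof -
  interpret rooted_tree_graph T r
    using assms(1) by (simp add: rooted_tree_graph_def rooted_tree_graph_axioms_def rooted_tree_def)
  obtain p where "\<forall>i\<le>tree_dist T a b. \<forall>j\<le>tree_dist T a b.
    ancestor T r (path_node T a b i) (path_node T a b j) \<longleftrightarrow> j \<le> i \<and> i \<le> p \<or> p \<le> i \<and> i \<le> j"
    using ex_turning_position[OF assms(2,3)] by blast
  then have "tree_segment T r a b p"
    using assms by unfold_locales auto
  then show ?thesis ..
qed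

section \<open>Products of trees\<close>

text \<open>One turning position \<open>p i\<close> is fixed for each coordinate, so that a single
  vector \<open>p\<close> serves the whole product.\<close>

locale tree_segment_family =
  fixes n :: nat and T :: "nat \<Rightarrow> 'a pair_pre_digraph" and r x y :: "nat \<Rightarrow> 'a" and p :: "nat \<Rightarrow> nat"
  assumes x_in: "x \<in> tree_product n T" and y_in: "y \<in> tree_product n T"
    and segment: "\<And>i. i \<in> {1..n} \<Longrightarrow> tree_segment (T i) (r i) (x i) (y i) (p i)"
begin

definition len :: "nat \<Rightarrow> nat" where
  "len i = tree_dist (T i) (x i) (y i)"

definition node :: "(nat \<Rightarrow> nat) \<Rightarrow> nat \<Rightarrow> 'a" where
  "node s = (\<lambda>i\<in>{1..n}. path_node (T i) (x i) (y i) (s i))"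

lemma node_cong: "(\<And>i. i \<in> {1..n} \<Longrightarrow> s i = t i) \<Longrightarrow> node s = node t"
  by (auto simp: node_def)

lemma node_in: "node s \<in> tree_product n T"
proof -
  have "path_node (T i) (x i) (y i) k \<in> pverts (T i)" if "i \<in> {1..n}" for i k
  proof -
    interpret seg: tree_segment "T i" "r i" "x i" "y i" "p i" by (rule segment[OF that])
    show ?thesis by (rule seg.path_node_in_verts[OF seg.ends_in_verts])
  qed
  then show ?thesis by (auto simp: node_def tree_product_def)
qed

lemma node_0: "node (\<lambda>_. 0) = x"
proof (rule PiE_ext[OF node_in[unfolded tree_product_def] x_in[unfolded tree_product_def]])
  fix i assume i: "i \<in> {1..n}"
  then show "node (\<lambda>_. 0) i = x i"
    using tree_segment.pos_0[OF segment[OF i]] by (simp add: node_def)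
qed

lemma node_len: "node len = y"
proof (rule PiE_ext[OF node_in[unfolded tree_product_def] y_in[unfolded tree_product_def]])
  fix i assume i: "i \<in> {1..n}"
  then show "node len i = y i"
    using tree_segment.pos_len[OF segment[OF i]] by (simp add: node_def len_def)
qed

lemma componentwise_node:
  assumes "\<And>i. i \<in> {1..n} \<Longrightarrow> s i \<le> len i \<and> t i \<le> len i"
  shows "componentwise n T r tree_sqcap (node s) (node t) =
      node (\<lambda>i. sqcap_pos (p i) (s i) (t i))"
    and "componentwise n T r tree_sqcup (node s) (node t) =
      node (\<lambda>i. s i + t i - sqcap_pos (p i) (s i) (t i))"
    and "componentwise n T r (tree_up d) (node s) (node t) =
      node (\<lambda>i. up_pos d (p i) (s i) (t i))"
    and "componentwise n T r (tree_down d) (node s) (node t) =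
      node (\<lambda>i. s i + t i - up_pos d (p i) (s i) (t i))"
  using assms tree_segment.tree_sqcap_pos[OF segment] tree_segment.tree_sqcup_pos[OF segment]
    tree_segment.tree_up_pos[OF segment] tree_segment.tree_down_pos[OF segment]
  by (auto simp: componentwise_def node_def len_def intro!: restrict_ext)

lemma position_box_node: "position_box {1..n} (\<lambda>s. f (node s))"
  by unfold_locales (simp, metis node_cong)

lemma up_down_le:
  assumes "strongly_tree_submodular n T r f"
  shows "f (componentwise n T r (tree_up d) x y) + f (componentwise n T r (tree_down d) x y) \<le> f x + f y"
proof -
  interpret position_box "{1..n}" "\<lambda>s. f (node s)" by (rule position_box_node)
  interpret midpoint_box "{1..n}" "\<lambda>s. f (node s)" len p
  proof
    fix s t assume st: "\<And>i. i \<in> {1..n} \<Longrightarrow> s i \<le> len i \<and> t i \<le> len i"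
    show "f (node (\<lambda>i. sqcap_pos (p i) (s i) (t i))) +
        f (node (\<lambda>i. s i + t i - sqcap_pos (p i) (s i) (t i))) \<le> f (node s) + f (node t)"
      using assms node_in[of s] node_in[of t] componentwise_node(1,2)[OF st]
      by (fastforce simp: strongly_tree_submodular_def)
  qed
  show ?thesis
    \<comment> \<open>\<open>x\<close> and \<open>y\<close> are the position vectors
      \<open>0\<close> and \<open>len\<close>, so the inequality for \<open>s \<le> t\<close>
      applies.\<close>
    using up_ineq[of "\<lambda>_. 0" len "\<lambda>i. up_pos d (p i) 0 (len i)" d]
      componentwise_node(3,4)[of "\<lambda>_. 0" len d]
    by (simp add: node_0 node_len)
qed

text \<open>The hypothesis ranges over all pairs of points, since the chain from \<open>x\<close>,
  \<open>y\<close> to their middle nodes passes through intermediate points on the paths.\<close>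

lemma sqcap_sqcup_le:
  fixes f :: "(nat \<Rightarrow> 'a) \<Rightarrow> real"
  assumes "\<And>x y d. x \<in> tree_product n T \<Longrightarrow> y \<in> tree_product n T \<Longrightarrow>
    f (componentwise n T r (tree_up d) x y) + f (componentwise n T r (tree_down d) x y) \<le> f x + f y"
  shows "f (componentwise n T r tree_sqcap x y) + f (componentwise n T r tree_sqcup x y) \<le> f x + f y"
proof -
  interpret position_box "{1..n}" "\<lambda>s. f (node s)" by (rule position_box_node)
  interpret up_box "{1..n}" "\<lambda>s. f (node s)" len p
  proof
    fix s t d assume st: "\<And>i. i \<in> {1..n} \<Longrightarrow> s i \<le> len i \<and> t i \<le> len i"
    show "f (node (\<lambda>i. up_pos d (p i) (s i) (t i))) +
        f (node (\<lambda>i. s i + t i - up_pos d (p i) (s i) (t i))) \<le> f (node s) + f (node t)"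
      using assms[OF node_in[of s] node_in[of t], of d] componentwise_node(3,4)[OF st, where d = d]
      by simp
  qed
  show ?thesis
    using midpoint_ineq[of "\<lambda>_. 0" len] componentwise_node(1,2)[of "\<lambda>_. 0" len]
    by (simp add: node_0 node_len)
qed

end

lemma ex_tree_segment_family:
  assumes "\<And>i. i \<in> {1..n} \<Longrightarrow> rooted_tree (T i) (r i)"
    and "x \<in> tree_product n T" "y \<in> tree_product n T"
  shows "\<exists>p. tree_segment_family n T r x y p"
proof -
  have "\<forall>i\<in>{1..n}. \<exists>p. tree_segment (T i) (r i) (x i) (y i) p"
    using assms by (auto intro!: ex_tree_segment simp: tree_product_def)
  then obtain p where "\<forall>i\<in>{1..n}. tree_segment (T i) (r i) (x i) (y i) (p i)"
    by (rule bchoice[THEN exE])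
  then have "tree_segment_family n T r x y p"
    using assms by (intro tree_segment_family.intro) auto
  then show ?thesis by blast
qed

theorem theorem4:
  fixes n :: nat
    and T :: "nat \<Rightarrow> 'a pair_pre_digraph"
    and r :: "nat \<Rightarrow> 'a"
    and f :: "(nat \<Rightarrow> 'a) \<Rightarrow> real"
  assumes "\<And>i. i \<in> {1..n} \<Longrightarrow> rooted_tree (T i) (r i)"
  shows "(strongly_tree_submodular n T r f \<longrightarrow>
            (\<forall>x\<in>tree_product n T. \<forall>y\<in>tree_product n T. \<forall>d::nat.
               f x + f y \<ge> f (componentwise n T r (tree_up d) x y)
                         + f (componentwise n T r (tree_down d) x y))) \<and>
         ((\<forall>x\<in>tree_product n T. \<forall>y\<in>tree_product n T. \<forall>d::nat.
               f x + f y \<ge> f (componentwise n T r (tree_up d) x y)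
                         + f (componentwise n T r (tree_down d) x y)) \<longrightarrow>
          strongly_tree_submodular n T r f)"
proof (intro conjI impI ballI allI)
  fix x y d
  assume submodular: "strongly_tree_submodular n T r f"
    and "x \<in> tree_product n T" "y \<in> tree_product n T"
  then obtain p where "tree_segment_family n T r x y p"
    using ex_tree_segment_family[of n T r x y] assms by blast
  then show "f (componentwise n T r (tree_up d) x y) + f (componentwise n T r (tree_down d) x y)
      \<le> f x + f y"
    using submodular by (rule tree_segment_family.up_down_le)
next
  assume up_down: "\<forall>x\<in>tree_product n T. \<forall>y\<in>tree_product n T. \<forall>d::nat.
    f x + f y \<ge> f (componentwise n T r (tree_up d) x y) + f (componentwise n T r (tree_down d) x y)"
  show "strongly_tree_submodular n T r f"
    unfolding strongly_tree_submodular_def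
  proof (intro ballI)
    fix x y assume "x \<in> tree_product n T" "y \<in> tree_product n T"
    then obtain p where "tree_segment_family n T r x y p"
      using ex_tree_segment_family[of n T r x y] assms by blast
    then show "f (componentwise n T r tree_sqcap x y) + f (componentwise n T r tree_sqcup x y)
        \<le> f x + f y"
      by (rule tree_segment_family.sqcap_sqcup_le) (use up_down in blast)
  qed
qed

end
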